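(* Let $\Sigma = \{0,1,2,3\}$. There is a finitely generated subgroup $G$ of $\mathrm{Aut}(\Sigma^{\mathbb{Z}})$ that acts $\infty$-orbit-transitively on the set $X_0$ of nonzero finite points of $\Sigma^{\mathbb{Z}}$. That is, $g(X_0) \subset X_0$ for all $g \in G$, and for every $k \ge 1$ and all $k$-tuples $(x_1,\ldots,x_k), (y_1,\ldots,y_k) \in X_0^k$ such that $x_1,\ldots,x_k$ lie in pairwise different $\sigma$-orbits and $y_1,\ldots,y_k$ lie in pairwise different $\sigma$-orbits, there exists $g \in G$ with $g(x_i) = y_i$ for all $i \in \{1,\ldots,k\}$.
   Context: $\Sigma^{\mathbb{Z}}$ has the product topology ($\Sigma$ discrete), and the shift is $\sigma(x)_i = x_{i+1}$. $\mathrm{Aut}(\Sigma^{\mathbb{Z}})$ is the group, under composition, of homeomorphisms $f : \Sigma^{\mathbb{Z}} \to \Sigma^{\mathbb{Z}}$ commuting with $\sigma$. The $\sigma$-orbit of $x$ is $\{\sigma^n(x) \mid n \in \mathbb{Z}\}$. A nonzero finite point is a point $x \in \Sigma^{\mathbb{Z}}$ whose support $\{i \mid x_i \neq 0\}$ is finite and nonempty. *)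

theory Defs
  imports "HOL-Analysis.Analysis" "HOL-Algebra.Generated_Groups"
begin

definition full_shift_topology :: "(int \<Rightarrow> 'a) topology" where
  "full_shift_topology = product_topology (\<lambda>_. discrete_topology UNIV) UNIV"

definition shift :: "(int \<Rightarrow> 'a) \<Rightarrow> (int \<Rightarrow> 'a)" where
  "shift x = (\<lambda>i. x (i + 1))"

definition full_shift_Aut :: "((int \<Rightarrow> 'a) \<Rightarrow> (int \<Rightarrow> 'a)) monoid" where
  "full_shift_Aut =
    \<lparr>carrier = {f. homeomorphic_map full_shift_topology full_shift_topology f \<and>
                   f \<circ> shift = shift \<circ> f},
     mult = (\<circ>),
     one = id\<rparr>"

(* The power is the integer power in the group of automorphisms; see shift_int_pow. *)
definition shift_orbit :: "(int \<Rightarrow> 'a) \<Rightarrow> (int \<Rightarrow> 'a) set" where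
  "shift_orbit x = {(shift [^]\<^bsub>full_shift_Aut\<^esub> n) x | n :: int. True}"

definition nonzero_finite_points :: "(int \<Rightarrow> 'a::zero) set" where
  "nonzero_finite_points = {x. finite {i. x i \<noteq> 0} \<and> {i. x i \<noteq> 0} \<noteq> {}}"

definition finitely_generated_subgroup :: "'g set \<Rightarrow> ('g, 'b) monoid_scheme \<Rightarrow> bool" where
  "finitely_generated_subgroup H G \<longleftrightarrow>
     subgroup H G \<and> (\<exists>S. finite S \<and> S \<subseteq> carrier G \<and> H = generate G S)"

(* A k-tuple is a function on nat of which only the values at 1, ..., k matter. *)
definition inf_orbit_transitive_on ::
    "((int \<Rightarrow> 'a) \<Rightarrow> (int \<Rightarrow> 'a)) set \<Rightarrow> (int \<Rightarrow> 'a) set \<Rightarrow> bool" where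
  "inf_orbit_transitive_on G X \<longleftrightarrow>
     (\<forall>g\<in>G. g ` X \<subseteq> X) \<and>
     (\<forall>k\<ge>1. \<forall>x y :: nat \<Rightarrow> int \<Rightarrow> 'a.
        (\<forall>i\<in>{1..k}. x i \<in> X) \<longrightarrow> (\<forall>i\<in>{1..k}. y i \<in> X) \<longrightarrow>
        (\<forall>i\<in>{1..k}. \<forall>j\<in>{1..k}. i \<noteq> j \<longrightarrow> shift_orbit (x i) \<noteq> shift_orbit (x j)) \<longrightarrow>
        (\<forall>i\<in>{1..k}. \<forall>j\<in>{1..k}. i \<noteq> j \<longrightarrow> shift_orbit (y i) \<noteq> shift_orbit (y j)) \<longrightarrow>
        (\<exists>g\<in>G. \<forall>i\<in>{1..k}. g (x i) = y i))"

lemma UNIV_4: "(UNIV :: 4 set) = {0, 1, 2, 3}"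
proof -
  have "card {0, 1, 2, 3 :: 4} = CARD(4)"
    by simp
  then show ?thesis
    by (intro card_subset_eq[symmetric]) auto
qed

lemma topspace_full_shift [simp]: "topspace full_shift_topology = UNIV"
  by (simp add: full_shift_topology_def)

lemma group_full_shift_Aut: "group (full_shift_Aut :: ((int \<Rightarrow> 'a) \<Rightarrow> (int \<Rightarrow> 'a)) monoid)"
proof (rule groupI)
  let ?T = "full_shift_topology :: (int \<Rightarrow> 'a) topology"
  fix f :: "(int \<Rightarrow> 'a) \<Rightarrow> (int \<Rightarrow> 'a)" assume "f \<in> carrier full_shift_Aut"
  then have hom: "homeomorphic_map ?T ?T f" and comm: "f \<circ> shift = shift \<circ> f"
    by (auto simp: full_shift_Aut_def)
  then obtain g where g: "homeomorphic_maps ?T ?T f g"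
    by (auto simp: homeomorphic_map_maps)
  then have gf: "g (f x) = x" and fg: "f (g x) = x" for x
    by (auto simp: homeomorphic_maps_def)
  have "homeomorphic_map ?T ?T g"
    using g homeomorphic_maps_map by blast
  moreover have "g \<circ> shift = shift \<circ> g"
  proof
    fix x
    have "f (shift (g x)) = shift x"
      using fun_cong[OF comm, of "g x"] by (simp add: fg)
    then show "(g \<circ> shift) x = (shift \<circ> g) x"
      using gf[of "shift (g x)"] by simp
  qed
  ultimately show "\<exists>g\<in>carrier full_shift_Aut. g \<otimes>\<^bsub>full_shift_Aut\<^esub> f = \<one>\<^bsub>full_shift_Aut\<^esub>"
    by (intro bexI[of _ g]) (auto simp: full_shift_Aut_def gf)
next
  fix f g :: "(int \<Rightarrow> 'a) \<Rightarrow> (int \<Rightarrow> 'a)"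
  assume "f \<in> carrier full_shift_Aut" "g \<in> carrier full_shift_Aut"
  then show "f \<otimes>\<^bsub>full_shift_Aut\<^esub> g \<in> carrier full_shift_Aut"
    by (auto simp: full_shift_Aut_def intro: homeomorphic_map_compose) (metis comp_assoc)
qed (auto simp: full_shift_Aut_def)

lemma homeomorphic_map_translate:
  "homeomorphic_map full_shift_topology full_shift_topology (\<lambda>(x :: int \<Rightarrow> 'a) i. x (i + n))"
proof -
  have cont: "continuous_map full_shift_topology full_shift_topology
      (\<lambda>(x :: int \<Rightarrow> 'a) i. x (i + m))" for m
    unfolding full_shift_topology_def continuous_map_componentwise_UNIV
    by (auto intro: continuous_map_product_projection)
  have "homeomorphic_maps full_shift_topology full_shift_topology
      (\<lambda>(x :: int \<Rightarrow> 'a) i. x (i + n)) (\<lambda>x i. x (i + (- n)))"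
    unfolding homeomorphic_maps_def using cont[of n] cont[of "- n"] by simp
  then show ?thesis
    using homeomorphic_maps_map by blast
qed

lemma translate_in_Aut: "(\<lambda>(x :: int \<Rightarrow> 'a) i. x (i + n)) \<in> carrier full_shift_Aut"
  using homeomorphic_map_translate[of n]
  by (auto simp: full_shift_Aut_def shift_def fun_eq_iff algebra_simps)

lemma shift_in_Aut: "shift \<in> carrier full_shift_Aut"
  using translate_in_Aut[of 1] by (simp add: shift_def[abs_def])

lemma shift_int_pow:
  "shift [^]\<^bsub>full_shift_Aut\<^esub> (n :: int) = (\<lambda>(x :: int \<Rightarrow> 'a) i. x (i + n))"
proof -
  interpret group "full_shift_Aut :: ((int \<Rightarrow> 'a) \<Rightarrow> (int \<Rightarrow> 'a)) monoid"
    by (rule group_full_shift_Aut)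
  let ?A = "full_shift_Aut :: ((int \<Rightarrow> 'a) \<Rightarrow> (int \<Rightarrow> 'a)) monoid"
  have nat: "shift [^]\<^bsub>?A\<^esub> (m :: nat) = (\<lambda>x i. x (i + int m))" for m
  proof (induction m)
    case 0
    show ?case by (simp add: full_shift_Aut_def fun_eq_iff)
  next
    case (Suc m)
    have "shift [^]\<^bsub>?A\<^esub> Suc m = (\<lambda>x i. x (i + int m)) \<circ> shift"
      using Suc by (simp add: full_shift_Aut_def)
    then show ?case by (simp del: nat_pow_Suc add: shift_def[abs_def] comp_def algebra_simps)
  qed
  show ?thesis
  proof (cases "n \<ge> 0")
    case True
    then have "shift [^]\<^bsub>?A\<^esub> n = shift [^]\<^bsub>?A\<^esub> nat n"
      by (simp only: int_pow_def2 not_less[symmetric] if_False)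
    also have "\<dots> = (\<lambda>x i. x (i + int (nat n)))"
      by (rule nat)
    finally show ?thesis
      using True by (simp only: int_nat_eq if_True)
  next
    case False
    then have neg: "n < 0" and "int (nat (- n)) = - n"
      by simp_all
    then have "shift [^]\<^bsub>?A\<^esub> nat (- n) = (\<lambda>x i. x (i + (- n)))"
      by (simp only: nat)
    with neg have "shift [^]\<^bsub>?A\<^esub> n = inv\<^bsub>?A\<^esub> (\<lambda>x i. x (i + (- n)))"
      by (simp only: int_pow_def2 if_True)
    also have "\<dots> = (\<lambda>x i. x (i + n))"
      by (rule inv_equality[OF _ translate_in_Aut translate_in_Aut])
        (simp add: full_shift_Aut_def fun_eq_iff)
    finally show ?thesis .
  qed
qed

end

theory Submission
  imports Defs
begin

text \<open>
  A symbol is a pair of bits, so a point is a pair \<open>(a, b)\<close> of binary tracks. The group is generated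
  by the shift of the first track alone, the exchange of the tracks, \<open>b := b + a\<close> and the two gates
  that add \<open>b (i + 1)\<close> to \<open>b i\<close> wherever \<open>a\<close> has an upward (respectively downward) step at \<open>i\<close>.

  Consider the local rules \<open>p\<close> for which the group contains \<open>b := b + p(a)\<close>. They are closed under
  addition and translation, and, by commutators with the step gates, under multiplication by the
  indicators of the steps of \<open>a\<close>. These indicators determine a nonzero finite track, so the rules
  separate the orbits of finite tracks. Hence \<open>b\<close> can be replaced by any finite track while a given
  finite set of points is fixed, as long as the orbit of \<open>a\<close> does not occur as a first track in
  that set; the same holds with the tracks exchanged. Adding far translates of one track to the
  other makes the first track determine the orbit of the point, so this condition can always be
  achieved. Thus the stabilizer of finitely many points is transitive on the points outside their
  orbits, and transitivity on tuples follows by induction.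
\<close>

section \<open>Translates of finite binary tracks\<close>

definition translate :: "int \<Rightarrow> (int \<Rightarrow> 'a) \<Rightarrow> int \<Rightarrow> 'a" where
  "translate n a = (\<lambda>i. a (i + n))"

lemma translate_apply [simp]: "translate n a i = a (i + n)"
  by (simp add: translate_def)

lemma translate_translate [simp]: "translate m (translate n a) = translate (m + n) a"
  by (simp add: translate_def algebra_simps)

lemma translate_0 [simp]: "translate 0 a = a"
  by (simp add: translate_def)

lemma finite_supports_bounded:
  fixes C :: "(int \<Rightarrow> bool) set"
  assumes "finite C" "\<And>a. a \<in> C \<Longrightarrow> finite (Collect a)"
  shows "\<exists>M\<ge>0. \<forall>a\<in>C. \<forall>i. a i \<longrightarrow> \<bar>i\<bar> \<le> M"
proof -
  have fin: "finite (\<Union>a\<in>C. Collect a)"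
    using assms by blast
  define M where "M = Max (insert 0 (abs ` (\<Union>a\<in>C. Collect a)))"
  have "0 \<le> M" and "\<And>a i. a \<in> C \<Longrightarrow> a i \<Longrightarrow> \<bar>i\<bar> \<le> M"
    unfolding M_def using fin by (auto intro!: Max_ge)
  then show ?thesis by blast
qed

text \<open>Since \<open>a\<close> has a one in \<open>[-M, M]\<close>, agreement on the window
  forces a one of \<open>f\<close> nearby, so \<open>i\<close> is at most \<open>2 * M\<close> in
  absolute value. Beyond the window of radius \<open>3 * M\<close> both sides are then zero.\<close>

lemma translate_eq_of_window:
  fixes a f :: "int \<Rightarrow> bool"
  assumes a: "\<And>i. a i \<Longrightarrow> \<bar>i\<bar> \<le> M" and f: "\<And>i. f i \<Longrightarrow> \<bar>i\<bar> \<le> M"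
    and "a k" and window: "\<And>k. \<bar>k\<bar> \<le> 3 * M \<Longrightarrow> f (k + i) = a k"
  shows "translate i f = a"
proof -
  have "\<bar>k\<bar> \<le> M" using a \<open>a k\<close> by blast
  then have "f (k + i)" using window[of k] \<open>a k\<close> by simp
  then have i: "\<bar>i\<bar> \<le> 2 * M" using f[of "k + i"] \<open>\<bar>k\<bar> \<le> M\<close> by linarith
  show ?thesis
  proof
    fix j
    show "translate i f j = a j"
    proof (cases "\<bar>j\<bar> \<le> 3 * M")
      case True then show ?thesis using window by simp
    next
      case False
      then have "\<not> \<bar>j\<bar> \<le> M" "\<not> \<bar>j + i\<bar> \<le> M" using i by linarith+
      then show ?thesis using a[of j] f[of "j + i"] by auto
    qed
  qed
qed

text \<open>A nonzero period would repeat the one at \<open>k\<close> at infinitely many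
  places.\<close>

lemma translate_eq_self:
  fixes a :: "int \<Rightarrow> bool"
  assumes "finite (Collect a)" "a k" "translate i a = a"
  shows "i = 0"
proof (rule ccontr)
  assume "i \<noteq> 0"
  have iter: "a (k + int n * i)" for n
  proof (induction n)
    case (Suc n)
    then show ?case
      using fun_cong[OF assms(3), of "k + int n * i"] by (simp add: algebra_simps)
  qed (simp add: \<open>a k\<close>)
  have "inj (\<lambda>n. k + int n * i)"
    using \<open>i \<noteq> 0\<close> by (auto simp: inj_def)
  then have "infinite (range (\<lambda>n. k + int n * i))"
    using range_inj_infinite by blast
  moreover have "range (\<lambda>n. k + int n * i) \<subseteq> Collect a"
    using iter by auto
  ultimately show False
    using assms(1) finite_subset by blast
qed

section \<open>Gates on pairs of binary tracks\<close>

type_synonym tracks = "(int \<Rightarrow> bool) \<times> (int \<Rightarrow> bool)"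

definition translate2 :: "int \<Rightarrow> tracks \<Rightarrow> tracks" where
  "translate2 n = map_prod (translate n) (translate n)"

definition nonzero_finite_tracks :: "tracks set" where
  "nonzero_finite_tracks =
    {(a, b). finite (Collect a) \<and> finite (Collect b) \<and> (\<exists>i. a i \<or> b i)}"

text \<open>Bits are booleans, so addition modulo 2 is \<open>\<noteq>\<close>. The rule sees
  \<open>a\<close> recentred at the cell that it changes.\<close>

definition add_gate :: "((int \<Rightarrow> bool) \<Rightarrow> bool) \<Rightarrow> tracks \<Rightarrow> tracks" where
  "add_gate p = (\<lambda>(a, b). (a, \<lambda>i. b i \<noteq> p (translate i a)))"

definition step :: "bool \<Rightarrow> (int \<Rightarrow> bool) \<Rightarrow> bool" where
  "step v c \<longleftrightarrow> c 0 = v \<and> c 1 = (\<not> v)"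

text \<open>Invertible because a step of \<open>a\<close> at \<open>i\<close> excludes one in the same direction at \<open>i + 1\<close>,
  so that the bit \<open>b (i + 1)\<close> that is read is not changed.\<close>

definition controlled_gate :: "bool \<Rightarrow> tracks \<Rightarrow> tracks" where
  "controlled_gate v = (\<lambda>(a, b). (a, \<lambda>i. b i \<noteq> (step v (translate i a) \<and> b (i + 1))))"

definition first_shift :: "int \<Rightarrow> tracks \<Rightarrow> tracks" where
  "first_shift n = map_prod (translate n) id"

lemma add_gate_involution: "add_gate p \<circ> add_gate p = id"
  by (auto simp: add_gate_def fun_eq_iff)

lemma controlled_gate_involution: "controlled_gate v \<circ> controlled_gate v = id"
  by (auto simp: controlled_gate_def fun_eq_iff step_def add.commute add.left_commute)

lemma first_shift_comp: "first_shift m \<circ> first_shift n = first_shift (m + n)"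
  by (auto simp: first_shift_def fun_eq_iff add.commute add.left_commute)

lemma first_shift_0: "first_shift 0 = id"
  by (auto simp: first_shift_def fun_eq_iff)

text \<open>Steps in both directions tell whether neighbouring cells differ, which determines a
  track on the window up to complement. The common one at \<open>k0\<close> removes that ambiguity,
  and the agreement spreads from \<open>k0\<close> to both sides.\<close>

lemma window_of_steps:
  assumes steps: "\<And>k v. -N \<le> k \<Longrightarrow> k < N \<Longrightarrow> step v (translate k c) = step v (translate k a)"
    and "c k0" "a k0" "\<bar>k0\<bar> \<le> N" and "\<bar>k\<bar> \<le> N"
  shows "c k = a k"
proof -
  have change: "(c k = c (k + 1)) = (a k = a (k + 1))" if "-N \<le> k" "k < N" for k
    using steps[OF that, of True] steps[OF that, of False]
    by (auto simp: step_def add.commute)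
  have up: "k \<le> N \<longrightarrow> c k = a k" if "k0 \<le> k" for k
    using that
  proof (induction k rule: int_ge_induct)
    case base then show ?case using assms by simp
  next
    case (step i)
    then show ?case using change[of i] assms(4) by auto
  qed
  have down: "-N \<le> k \<longrightarrow> c k = a k" if "k \<le> k0" for k
    using that
  proof (induction k rule: int_le_induct)
    case base then show ?case using assms by simp
  next
    case (step i)
    then show ?case using change[of "i - 1"] assms(4) by auto
  qed
  show ?thesis using up[of k] down[of k] \<open>\<bar>k\<bar> \<le> N\<close> by linarith
qed

section \<open>Adding far translates of one track to the other\<close>

definition add_first :: "int \<Rightarrow> tracks \<Rightarrow> tracks" where
  "add_first N = (\<lambda>(a, b). (a, \<lambda>i. b i \<noteq> a (i + N)))"

definition add_second :: "int \<Rightarrow> tracks \<Rightarrow> tracks" where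
  "add_second N = (\<lambda>(a, b). (\<lambda>i. a i \<noteq> b (i + N), b))"

text \<open>The new first track consists of two distant blocks, a copy of \<open>a\<close> around 0
  and a copy of \<open>b\<close> around \<open>-N\<close>. As both \<open>b\<close> and
  \<open>b'\<close> are nonzero, a translation that matches two such tracks must match block with
  block.\<close>

lemma orbit_of_first_track:
  assumes bound: "\<And>i. a i \<or> b i \<or> a' i \<or> b' i \<Longrightarrow> \<bar>i\<bar> \<le> M"
    and "b k" "b' k'" and N: "N > 6 * M" "M \<ge> 0"
    and eq: "fst (add_second N (a, b)) = translate s (fst (add_second N (a', b')))"
  shows "(a, b) = translate2 s (a', b')"
proof -
  have eq': "(a i \<noteq> b (i + N)) = (a' (i + s) \<noteq> b' (i + s + N))" for i
    using fun_cong[OF eq, of i] by (simp add: add_second_def)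
  have k: "\<bar>k\<bar> \<le> M" "\<bar>k'\<bar> \<le> M"
    using bound assms by blast+
  have na: "\<not> a i" "\<not> b i" "\<not> a' i" "\<not> b' i" if "\<bar>i\<bar> > M" for i
    using bound[of i] that by auto
  \<comment> \<open>A one in the far block on the left lands in one of the two blocks on the right,
    so \<open>s\<close> is near \<open>N\<close> or near 0. The symmetric argument gives
    \<open>s\<close> near \<open>-N\<close> or near 0; only 0 is compatible with both.\<close>
  have "a' (k - N + s) \<or> b' (k + s)"
    using eq'[of "k - N"] na(1)[of "k - N"] k N \<open>b k\<close> by (auto simp: algebra_simps)
  then have 1: "\<bar>k - N + s\<bar> \<le> M \<or> \<bar>k + s\<bar> \<le> M"
    using bound by blast
  have "a (k' - N - s) \<or> b (k' - s)"
    using eq'[of "k' - N - s"] na(3)[of "k' - N"] k N \<open>b' k'\<close> by (auto simp: algebra_simps)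
  then have 2: "\<bar>k' - N - s\<bar> \<le> M \<or> \<bar>k' - s\<bar> \<le> M"
    using bound by blast
  have s: "\<bar>s\<bar> \<le> 2 * M"
    using 1 2 k N by linarith
  have "a i = a' (i + s)" for i
  proof (cases "\<bar>i\<bar> \<le> 3 * M")
    case True
    then have "\<bar>i + N\<bar> > M" "\<bar>i + s + N\<bar> > M" using N s by linarith+
    then show ?thesis using eq'[of i] na by auto
  next
    case False
    then have "\<bar>i\<bar> > M" "\<bar>i + s\<bar> > M" using N s by linarith+
    then show ?thesis using na by auto
  qed
  moreover have "b i = b' (i + s)" for i
  proof (cases "\<bar>i\<bar> \<le> 3 * M")
    \<comment> \<open>The bound \<open>6 * M\<close> is the sum of \<open>3 * M\<close> for the cell
      \<open>i\<close>, \<open>2 * M\<close> for \<open>s\<close> and \<open>M\<close> for the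
      supports: the other block contributes nothing here.\<close>
    case True
    then have "\<bar>i - N\<bar> > M" "\<bar>i - N + s\<bar> > M" using N s by linarith+
    then show ?thesis using eq'[of "i - N"] na by (auto simp: algebra_simps)
  next
    case False
    then have "\<bar>i\<bar> > M" "\<bar>i + s\<bar> > M" using N s by linarith+
    then show ?thesis using na by auto
  qed
  ultimately show ?thesis
    by (auto simp: translate2_def translate_def)
qed

lemma add_first_translate2: "add_first N (translate2 s x) = translate2 s (add_first N x)"
  by (cases x) (simp add: add_first_def translate2_def translate_def fun_eq_iff ac_simps)

lemma add_first_inj: "add_first N x = add_first N y \<Longrightarrow> x = y"
  by (auto simp: add_first_def fun_eq_iff split: prod.splits)

lemma finite_support_add_translate:
  assumes "finite (Collect a)" "finite (Collect b)"
  shows "finite {i :: int. a i \<noteq> b (i + N)}"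
proof -
  have "finite ((\<lambda>i. i - N) ` Collect b)" using assms by simp
  moreover have "{i. a i \<noteq> b (i + N)} \<subseteq> Collect a \<union> (\<lambda>i. i - N) ` Collect b"
    by (auto simp: image_iff) (metis add_diff_cancel_right')+
  ultimately show ?thesis using assms finite_subset by blast
qed

section \<open>Transitivity of the group of gates\<close>

text \<open>Only closure properties and the presence of the generators are assumed, so that
  \<open>G\<close> may be the set of all gates whose action on four symbols lies in the generated
  subgroup.\<close>

locale gate_group =
  fixes G :: "(tracks \<Rightarrow> tracks) set"
  assumes comp: "g \<in> G \<Longrightarrow> h \<in> G \<Longrightarrow> g \<circ> h \<in> G"
    and inverse: "g \<in> G \<Longrightarrow> g \<circ> h = id \<Longrightarrow> h \<circ> g = id \<Longrightarrow> h \<in> G"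
    and swap: "prod.swap \<in> G"
    and first_shift_1: "first_shift 1 \<in> G"
    and add_gate_0: "add_gate (\<lambda>c. c 0) \<in> G"
    and controlled: "controlled_gate v \<in> G"
begin

lemma id_in: "id \<in> G"
proof -
  have "prod.swap \<circ> prod.swap \<in> G"
    using comp[OF swap swap] .
  then show ?thesis
    by (metis comp_id swap_comp_swap)
qed

lemma first_shift_in: "first_shift n \<in> G"
proof -
  have nat: "first_shift (int m) \<in> G" for m
  proof (induction m)
    case 0 show ?case using id_in by (simp only: first_shift_0 of_nat_0)
  next
    case (Suc m)
    then show ?case using comp[OF first_shift_1 Suc] by (simp add: first_shift_comp)
  qed
  show ?thesis
  proof (cases "n \<ge> 0")
    case True then show ?thesis using nat[of "nat n"] by simp
  next
    case False
    then have "first_shift (- n) \<in> G" using nat[of "nat (- n)"] by simp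
    then show ?thesis
      by (rule inverse) (simp_all add: first_shift_comp first_shift_0)
  qed
qed

section \<open>The rules realized in the group\<close>

definition rules :: "((int \<Rightarrow> bool) \<Rightarrow> bool) set" where
  "rules = {p. add_gate p \<in> G}"

lemma rules_xor:
  assumes "p \<in> rules" "q \<in> rules"
  shows "(\<lambda>c. p c \<noteq> q c) \<in> rules"
proof -
  have "add_gate p \<circ> add_gate q = add_gate (\<lambda>c. p c \<noteq> q c)"
    by (auto simp: add_gate_def fun_eq_iff)
  then show ?thesis
    using assms comp unfolding rules_def by force
qed

text \<open>Conjugation by a shift of the first track alone displaces the place where
  \<open>a\<close> is read against the place where \<open>b\<close> is written.\<close>

lemma rules_translate:
  assumes "p \<in> rules"
  shows "(\<lambda>c. p (translate n c)) \<in> rules"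
proof -
  have "first_shift (- n) \<circ> (add_gate p \<circ> first_shift n) = add_gate (\<lambda>c. p (translate n c))"
    by (auto simp: add_gate_def first_shift_def fun_eq_iff add.commute)
  then show ?thesis
    using assms comp first_shift_in unfolding rules_def by (metis mem_Collect_eq)
qed

text \<open>For fixed \<open>a\<close> the gate \<open>add_gate p\<close> is a translation of \<open>b\<close> and
  \<open>controlled_gate v\<close> is linear in \<open>b\<close>, so their commutator is again a translation.\<close>

lemma rules_step_0:
  assumes "p \<in> rules"
  shows "(\<lambda>c. step v c \<and> p c) \<in> rules"
proof -
  \<comment> \<open>The controlled gate carries the bit at \<open>i + 1\<close> to \<open>i\<close>,
    so \<open>q\<close> must evaluate at \<open>i + 1\<close> to what \<open>p\<close> gives at
    \<open>i\<close>.\<close>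
  define q where "q = (\<lambda>c. p (translate (- 1) c))"
  have "q \<in> rules"
    unfolding q_def by (rule rules_translate[OF assms])
  then have "controlled_gate v \<circ> (add_gate q \<circ> (controlled_gate v \<circ> add_gate q)) \<in> G"
    using comp controlled unfolding rules_def by auto
  moreover have "controlled_gate v \<circ> (add_gate q \<circ> (controlled_gate v \<circ> add_gate q)) =
      add_gate (\<lambda>c. step v c \<and> p c)"
    by (auto simp: add_gate_def controlled_gate_def fun_eq_iff q_def step_def
        add.commute add.left_commute)
  ultimately show ?thesis
    by (simp add: rules_def)
qed

text \<open>The step factor is moved to \<open>k\<close> by translating back and forth. The case of
  an absent step is \<open>p\<close> minus its product with the step indicator.\<close>

lemma rules_step:
  assumes "p \<in> rules"
  shows "(\<lambda>c. step v (translate k c) = w \<and> p c) \<in> rules"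
proof -
  have "(\<lambda>c. step v c \<and> p (translate (- k) c)) \<in> rules"
    using rules_step_0 rules_translate assms by blast
  from rules_translate[OF this, of k]
  have 1: "(\<lambda>c. step v (translate k c) \<and> p c) \<in> rules"
    by simp
  show ?thesis
  proof (cases w)
    case True then show ?thesis using 1 by simp
  next
    case False
    have "(\<lambda>c. p c \<noteq> (step v (translate k c) \<and> p c)) =
        (\<lambda>c. step v (translate k c) = w \<and> p c)"
      using False by auto
    then show ?thesis
      using rules_xor[OF assms 1] by simp
  qed
qed

text \<open>The factor \<open>p\<close> is the rule from which the induction starts. The constantly
  true rule could not serve: it would complement all of \<open>b\<close> and destroy finite
  supports.\<close>

lemma rules_steps:
  assumes "finite K" "p \<in> rules"
  shows "(\<lambda>c. (\<forall>k\<in>K. \<forall>v. step v (translate k c) = step v (translate k a)) \<and> p c) \<in> rules"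
  using assms(1)
proof (induction K rule: finite_induct)
  case empty then show ?case using assms(2) by simp
next
  case (insert k K)
  let ?s = "\<lambda>v c. step v (translate k c) = step v (translate k a)"
  let ?q = "\<lambda>c. (\<forall>k\<in>K. \<forall>v. step v (translate k c) = step v (translate k a)) \<and> p c"
  have "(\<lambda>c. ?s True c \<and> (?s False c \<and> ?q c)) \<in> rules"
    by (intro rules_step insert.IH)
  moreover have "(\<lambda>c. ?s True c \<and> (?s False c \<and> ?q c)) =
      (\<lambda>c. (\<forall>k\<in>insert k K. \<forall>v. step v (translate k c) = step v (translate k a)) \<and> p c)"
    by (intro ext) (simp add: all_bool_eq conj_ac)
  ultimately show ?case by (simp only:)
qed

lemma rule_separating:
  assumes "finite C" "\<And>c. c \<in> C \<Longrightarrow> finite (Collect c)" "finite (Collect a)" "a k0"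
    and orbit: "\<And>c s. c \<in> C \<Longrightarrow> a \<noteq> translate s c"
  shows "\<exists>p\<in>rules. (\<forall>i. p (translate i a) \<longleftrightarrow> i = 0) \<and> (\<forall>c\<in>C. \<forall>i. \<not> p (translate i c))"
proof -
  obtain M where M: "M \<ge> 0" "\<forall>c\<in>insert a C. \<forall>i. c i \<longrightarrow> \<bar>i\<bar> \<le> M"
    using finite_supports_bounded[of "insert a C"] assms by auto
  \<comment> \<open>A step at \<open>k\<close> compares the cells \<open>k\<close> and
    \<open>k + 1\<close>, so the half-open range covers exactly the cells from
    \<open>-(3 * M)\<close> to \<open>3 * M\<close>. The factor \<open>c k0\<close> is the starting
    rule and also excludes the complement of \<open>a\<close> on the window.\<close>
  define p where "p = (\<lambda>c. (\<forall>k\<in>{-(3 * M)..<3 * M}. \<forall>v.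
    step v (translate k c) = step v (translate k a)) \<and> c k0)"
  have "(\<lambda>c. c 0) \<in> rules"
    using add_gate_0 by (simp add: rules_def)
  from rules_translate[OF this, of k0] have "p \<in> rules"
    unfolding p_def by (intro rules_steps) simp_all
  moreover have eq: "translate i c = a" if "p (translate i c)" "c \<in> insert a C" for c i
  proof (rule translate_eq_of_window)
    show "\<And>i. a i \<Longrightarrow> \<bar>i\<bar> \<le> M" "\<And>i. c i \<Longrightarrow> \<bar>i\<bar> \<le> M"
      using M that by auto
    then have "\<bar>k0\<bar> \<le> 3 * M" using \<open>a k0\<close> M(1) by fastforce
    show "a k0" by fact
    fix k assume "\<bar>k\<bar> \<le> 3 * M"
    then have "translate i c k = a k"
      using that(1) \<open>a k0\<close> \<open>\<bar>k0\<bar> \<le> 3 * M\<close> window_of_steps[of "3 * M" "translate i c" a k0 k]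
      unfolding p_def by auto
    then show "c (k + i) = a k" by simp
  qed
  moreover have "p a" using \<open>a k0\<close> by (simp add: p_def)
  ultimately show ?thesis
    using orbit translate_eq_self[OF assms(3,4)] by (metis insertCI translate_0)
qed

text \<open>A separating rule marks a single position of \<open>a\<close>; the sum of its translates
  over \<open>D\<close> marks exactly \<open>D\<close>.\<close>

lemma rule_prescribed:
  assumes "finite C" "\<And>c. c \<in> C \<Longrightarrow> finite (Collect c)" "finite (Collect a)" "a k0"
    and orbit: "\<And>c s. c \<in> C \<Longrightarrow> a \<noteq> translate s c" and "finite D"
  shows "\<exists>p\<in>rules. (\<forall>i. p (translate i a) \<longleftrightarrow> i \<in> D) \<and> (\<forall>c\<in>C. \<forall>i. \<not> p (translate i c))"
proof -
  obtain q where q: "q \<in> rules" "\<And>i. q (translate i a) \<longleftrightarrow> i = 0"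
      "\<And>c i. c \<in> C \<Longrightarrow> \<not> q (translate i c)"
    using rule_separating[OF assms(1-5)] by metis
  show ?thesis
    using \<open>finite D\<close>
  proof (induction D rule: finite_induct)
    case empty
    have "(\<lambda>c. q c \<noteq> q c) \<in> rules" using q(1) by (intro rules_xor)
    then show ?case by (intro bexI[of _ "\<lambda>c. q c \<noteq> q c"]) auto
  next
    case (insert d D)
    then obtain p where p: "p \<in> rules" "\<And>i. p (translate i a) \<longleftrightarrow> i \<in> D"
      "\<And>c i. c \<in> C \<Longrightarrow> \<not> p (translate i c)" by metis
    have "(\<lambda>c. p c \<noteq> q (translate (- d) c)) \<in> rules"
      using p(1) q(1) by (intro rules_xor rules_translate)
    moreover have tr: "translate (- d) (translate i c) = translate (i - d) c" for i and c :: "int \<Rightarrow> bool"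
      by (simp add: translate_def algebra_simps)
    have "(p (translate i a) \<noteq> q (translate (- d) (translate i a))) \<longleftrightarrow> i \<in> insert d D" for i
      unfolding tr p(2) q(2) using insert.hyps(2) by auto
    moreover have "\<not> (p (translate i c) \<noteq> q (translate (- d) (translate i c)))" if "c \<in> C" for c i
      unfolding tr using p(3)[OF that] q(3)[OF that] by blast
    ultimately show ?case
      by (intro bexI[of _ "\<lambda>c. p c \<noteq> q (translate (- d) c)"] conjI ballI allI) assumption+
  qed
qed

section \<open>Replacing tracks while finitely many points stay fixed\<close>

lemma change_second:
  assumes "finite F" "\<And>c d. (c, d) \<in> F \<Longrightarrow> finite (Collect c)" "finite (Collect a)" "a k0"
    and "\<And>c d s. (c, d) \<in> F \<Longrightarrow> a \<noteq> translate s c"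
    and "finite (Collect b)" "finite (Collect b')"
  shows "\<exists>g\<in>G. g (a, b) = (a, b') \<and> (\<forall>f\<in>F. g f = f)"
proof -
  have "finite {i. b i \<noteq> b' i}"
    by (rule finite_subset[of _ "Collect b \<union> Collect b'"]) (use assms in auto)
  \<comment> \<open>The rule marks the cells where \<open>b\<close> and \<open>b'\<close> differ.
    Vanishing on all translates of first tracks of \<open>F\<close>, its gate fixes every point of
    \<open>F\<close>.\<close>
  then have "\<exists>p\<in>rules. (\<forall>i. p (translate i a) \<longleftrightarrow> i \<in> {i. b i \<noteq> b' i}) \<and>
      (\<forall>c\<in>fst ` F. \<forall>i. \<not> p (translate i c))"
  proof (intro rule_prescribed[where a = a and ?k0.0 = k0])
    show "finite (Collect c)" if "c \<in> fst ` F" for c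
      using assms(2) that by (metis imageE prod.collapse)
    show "a \<noteq> translate s c" if "c \<in> fst ` F" for c s
      using assms(5) that by (metis imageE prod.collapse)
  qed (use assms(1,3,4) in auto)
  then obtain p where p: "p \<in> rules" "\<And>i. p (translate i a) \<longleftrightarrow> b i \<noteq> b' i"
    "\<And>c i. c \<in> fst ` F \<Longrightarrow> \<not> p (translate i c)"
    by blast
  have "add_gate p (a, b) = (a, b')"
    using p(2) by (auto simp: add_gate_def)
  moreover have "add_gate p f = f" if "f \<in> F" for f
    using p(3)[of "fst f"] that by (auto simp: add_gate_def split: prod.splits)
  ultimately show ?thesis
    using p(1) unfolding rules_def by blast
qed

lemma change_first:
  assumes "finite F" "\<And>c d. (c, d) \<in> F \<Longrightarrow> finite (Collect d)" "finite (Collect b)" "b k0"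
    and "\<And>c d s. (c, d) \<in> F \<Longrightarrow> b \<noteq> translate s d"
    and "finite (Collect a)" "finite (Collect a')"
  shows "\<exists>g\<in>G. g (a, b) = (a', b) \<and> (\<forall>f\<in>F. g f = f)"
proof -
  have "\<exists>g\<in>G. g (b, a) = (b, a') \<and> (\<forall>f\<in>prod.swap ` F. g f = f)"
  proof (rule change_second[where ?k0.0 = k0])
    show "finite (Collect c)" if "(c, d) \<in> prod.swap ` F" for c d
      using assms(2) that by auto
    show "b \<noteq> translate s c" if "(c, d) \<in> prod.swap ` F" for c d s
      using assms(5) that by (metis imageE prod.collapse swap_simp prod.inject)
  qed (use assms in auto)
  then obtain g where g: "g \<in> G" "g (b, a) = (b, a')" "\<forall>f\<in>prod.swap ` F. g f = f"
    by blast
  have "prod.swap \<circ> (g \<circ> prod.swap) \<in> G"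
    using g(1) by (intro comp swap)
  then show ?thesis
    using g(2,3) by (intro bexI[of _ "prod.swap \<circ> (g \<circ> prod.swap)"]) auto
qed

text \<open>Three replacements suffice: \<open>(a, b)\<close> to \<open>(a, m)\<close> to
  \<open>(a', m)\<close> to \<open>(a', b')\<close>. The auxiliary track \<open>m\<close> is a safe
  control for the middle one, because its orbit does not occur among the second tracks of
  \<open>F\<close>.\<close>

lemma transitive_generic:
  assumes F: "finite F" "\<And>c d. (c, d) \<in> F \<Longrightarrow> finite (Collect c) \<and> finite (Collect d)"
    and fin: "finite (Collect a)" "finite (Collect b)" "finite (Collect a')" "finite (Collect b')"
    and "a k" "a' k'"
    and orbit: "\<And>c d s. (c, d) \<in> F \<Longrightarrow> a \<noteq> translate s c"
      "\<And>c d s. (c, d) \<in> F \<Longrightarrow> a' \<noteq> translate s c"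
  shows "\<exists>g\<in>G. g (a, b) = (a', b') \<and> (\<forall>f\<in>F. g f = f)"
proof -
  have F': "finite (Collect c)" "finite (Collect d)" if "(c, d) \<in> F" for c d
    using F(2) that by auto
  have "finite (snd ` F)" "\<And>d. d \<in> snd ` F \<Longrightarrow> finite (Collect d)"
    using F(1) F'(2) by auto
  then obtain M where M: "M \<ge> 0" "\<forall>d\<in>snd ` F. \<forall>i. d i \<longrightarrow> \<bar>i\<bar> \<le> M"
    using finite_supports_bounded[of "snd ` F"] by blast
  \<comment> \<open>Two ones at distance \<open>2 * M + 1\<close> cannot both fit into
    \<open>[-M, M]\<close>, where all second tracks of \<open>F\<close> are supported.\<close>
  define m where "m = (\<lambda>i :: int. i = 0 \<or> i = 2 * M + 1)"
  have m_fin: "finite (Collect m)"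
    by (simp add: m_def)
  have m_orbit: "m \<noteq> translate s d" if "(c, d) \<in> F" for c d s
  proof
    assume eq: "m = translate s d"
    have "d s" "d (s + (2 * M + 1))"
      using fun_cong[OF eq, of 0] fun_cong[OF eq, of "2 * M + 1"]
      by (simp_all add: m_def translate_def add.commute)
    moreover have "d \<in> snd ` F"
      using that by (metis image_eqI snd_conv)
    ultimately have "\<bar>s\<bar> \<le> M" "\<bar>s + (2 * M + 1)\<bar> \<le> M"
      using M(2) by blast+
    then show False by linarith
  qed
  have "m 0" by (simp add: m_def)
  have "\<exists>g\<in>G. g (a, b) = (a, m) \<and> (\<forall>f\<in>F. g f = f)"
    by (rule change_second[OF F(1) _ fin(1) \<open>a k\<close> _ fin(2) m_fin]) (erule F' orbit(1))+
  then obtain g1 where g1: "g1 \<in> G" "g1 (a, b) = (a, m)" "\<forall>f\<in>F. g1 f = f"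
    by blast
  have "\<exists>g\<in>G. g (a, m) = (a', m) \<and> (\<forall>f\<in>F. g f = f)"
    by (rule change_first[OF F(1) _ m_fin \<open>m 0\<close> _ fin(1,3)]) (erule F' m_orbit)+
  then obtain g2 where g2: "g2 \<in> G" "g2 (a, m) = (a', m)" "\<forall>f\<in>F. g2 f = f"
    by blast
  have "\<exists>g\<in>G. g (a', m) = (a', b') \<and> (\<forall>f\<in>F. g f = f)"
    by (rule change_second[OF F(1) _ fin(3) \<open>a' k'\<close> _ m_fin fin(4)]) (erule F' orbit(2))+
  then obtain g3 where g3: "g3 \<in> G" "g3 (a', m) = (a', b')" "\<forall>f\<in>F. g3 f = f"
    by blast
  show ?thesis
    using g1 g2 g3 by (intro bexI[of _ "g3 \<circ> (g2 \<circ> g1)"] comp) auto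
qed

section \<open>Reaching generic position\<close>

lemma add_first_in: "add_first N \<in> G"
proof -
  have "(\<lambda>c. c 0) \<in> rules"
    using add_gate_0 by (simp add: rules_def)
  from rules_translate[OF this, of N] show ?thesis
    by (simp add: rules_def add_gate_def add_first_def add.commute)
qed

lemma add_second_in: "add_second N \<in> G"
proof -
  have "prod.swap \<circ> (add_first N \<circ> prod.swap) = add_second N"
    by (auto simp: add_first_def add_second_def fun_eq_iff)
  then show ?thesis
    using comp swap add_first_in by metis
qed

text \<open>Two additions are made. The first makes every second track nonzero, as the comparison of
  blocks requires; the second then makes the first track determine the orbit.\<close>

lemma generic_position:
  assumes "finite F" "F \<subseteq> nonzero_finite_tracks"
  shows "\<exists>g\<in>G. \<forall>x\<in>F. finite (Collect (fst (g x))) \<and> finite (Collect (snd (g x))) \<and>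
    (\<exists>k. fst (g x) k) \<and> (\<forall>y\<in>F. \<forall>s. fst (g x) = translate s (fst (g y)) \<longrightarrow> x = translate2 s y)"
proof -
  have fin: "finite (Collect (fst x))" "finite (Collect (snd x))"
    and nz: "\<exists>i. fst x i \<or> snd x i" if "x \<in> F" for x
    using subsetD[OF assms(2) that] by (cases x; simp add: nonzero_finite_tracks_def)+
  have "finite (fst ` F \<union> snd ` F)" "\<And>c. c \<in> fst ` F \<union> snd ` F \<Longrightarrow> finite (Collect c)"
    using assms(1) fin by blast+
  then obtain L where L: "L \<ge> 0" "\<forall>c\<in>fst ` F \<union> snd ` F. \<forall>i. c i \<longrightarrow> \<bar>i\<bar> \<le> L"
    using finite_supports_bounded[of "fst ` F \<union> snd ` F"] by blast
  \<comment> \<open>The displacement \<open>2 * L + 1\<close> moves the added copy of the first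
    track off the support of the second, so that nothing cancels.\<close>
  define h where "h = add_first (2 * L + 1)"
  have h_fst: "fst (h x) = fst x" for x
    by (simp add: h_def add_first_def split: prod.splits)
  have h_snd: "snd (h x) = (\<lambda>i. snd x i \<noteq> fst x (i + (2 * L + 1)))" for x
    by (simp add: h_def add_first_def split: prod.splits)
  have h_fin: "finite (Collect (fst (h x)))" "finite (Collect (snd (h x)))" if "x \<in> F" for x
    using fin[OF that] finite_support_add_translate unfolding h_fst h_snd by auto
  have h_nz: "\<exists>k. snd (h x) k" if x: "x \<in> F" for x
  proof (cases "\<exists>i. fst x i")
    case True
    then obtain i where i: "fst x i" by blast
    then have "\<bar>i\<bar> \<le> L" using L(2) x by blast
    then have "\<not> \<bar>i - (2 * L + 1)\<bar> \<le> L" by linarith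
    then have "\<not> snd x (i - (2 * L + 1))" using L(2) x by blast
    then have "snd (h x) (i - (2 * L + 1))" using i unfolding h_snd by simp
    then show ?thesis by blast
  next
    case False
    then show ?thesis using nz[OF x] unfolding h_snd by auto
  qed
  have "finite ((fst \<circ> h) ` F \<union> (snd \<circ> h) ` F)"
      "\<And>c. c \<in> (fst \<circ> h) ` F \<union> (snd \<circ> h) ` F \<Longrightarrow> finite (Collect c)"
    using assms(1) h_fin by fastforce+
  then obtain M where M: "M \<ge> 0" "\<forall>c\<in>(fst \<circ> h) ` F \<union> (snd \<circ> h) ` F. \<forall>i. c i \<longrightarrow> \<bar>i\<bar> \<le> M"
    using finite_supports_bounded[of "(fst \<circ> h) ` F \<union> (snd \<circ> h) ` F"] by blast
  define N where "N = 6 * M + 1"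
  define g where "g = add_second N \<circ> h"
  have g_fst: "fst (g x) = (\<lambda>i. fst (h x) i \<noteq> snd (h x) (i + N))" for x
    by (simp add: g_def add_second_def split: prod.splits)
  have g_snd: "snd (g x) = snd (h x)" for x
    by (simp add: g_def add_second_def split: prod.splits)
  show ?thesis
  proof (intro bexI[of _ g] ballI conjI allI impI)
    show "g \<in> G"
      unfolding g_def h_def by (intro comp add_second_in add_first_in)
    fix x assume x: "x \<in> F"
    show "finite (Collect (fst (g x)))" "finite (Collect (snd (g x)))"
      using h_fin[OF x] finite_support_add_translate unfolding g_fst g_snd by auto
    show "\<exists>k. fst (g x) k"
    proof -
      obtain k where k: "snd (h x) k" using h_nz[OF x] by blast
      then have "\<bar>k\<bar> \<le> M" using M(2) x by auto
      then have "\<not> \<bar>k - N\<bar> \<le> M" using M(1) unfolding N_def by linarith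
      then have "\<not> fst (h x) (k - N)" using M(2) x by auto
      then have "fst (g x) (k - N)" using k unfolding g_fst by simp
      then show ?thesis by blast
    qed
    fix y s assume y: "y \<in> F" and eq: "fst (g x) = translate s (fst (g y))"
    obtain k k' where k: "snd (h x) k" "snd (h y) k'" using h_nz x y by blast
    have "(fst (h x), snd (h x)) = translate2 s (fst (h y), snd (h y))"
    proof (rule orbit_of_first_track)
      show "\<bar>i\<bar> \<le> M" if "fst (h x) i \<or> snd (h x) i \<or> fst (h y) i \<or> snd (h y) i" for i
        using M(2) x y that by auto
      show "fst (add_second N (fst (h x), snd (h x))) =
          translate s (fst (add_second N (fst (h y), snd (h y))))"
        using eq by (simp add: g_def)
    qed (use k M(1) in \<open>simp_all add: N_def\<close>)
    \<comment> \<open>Since \<open>h\<close> commutes with translations and is injective, the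
      relation between images holds between the points themselves.\<close>
    then have "h x = h (translate2 s y)"
      by (simp add: h_def add_first_translate2)
    then show "x = translate2 s y"
      unfolding h_def by (rule add_first_inj)
  qed
qed

lemma left_inverse_in:
  assumes "g \<in> G" "bij g"
  shows "\<exists>h\<in>G. \<forall>x. h (g x) = x"
proof -
  define h where "h = inv_into UNIV g"
  have h: "h \<circ> g = id" "g \<circ> h = id"
    unfolding h_def using \<open>bij g\<close> by (simp_all add: bij_is_inj bij_is_surj surj_iff[symmetric])
  then have "h \<in> G"
    using inverse[OF \<open>g \<in> G\<close>] by blast
  then show ?thesis
    using h by (auto simp: fun_eq_iff)
qed

text \<open>Conjugation by a gate \<open>g\<close> that puts \<open>x\<close>, \<open>y\<close> and
  \<open>F\<close> in generic position reduces this to the generic case: there, first tracks of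
  points in different orbits are not translates of each other.\<close>

lemma transitive_stabilizer:
  assumes bij: "\<And>g. g \<in> G \<Longrightarrow> bij g"
    and F: "finite F" "F \<subseteq> nonzero_finite_tracks"
    and xy: "x \<in> nonzero_finite_tracks" "y \<in> nonzero_finite_tracks"
    and orbit: "\<And>f s. f \<in> F \<Longrightarrow> x \<noteq> translate2 s f" "\<And>f s. f \<in> F \<Longrightarrow> y \<noteq> translate2 s f"
  shows "\<exists>g\<in>G. g x = y \<and> (\<forall>f\<in>F. g f = f)"
proof -
  let ?F = "{x, y} \<union> F"
  have "finite ?F" "?F \<subseteq> nonzero_finite_tracks"
    using F xy by auto
  from generic_position[OF this] obtain g where g: "g \<in> G" and
    generic: "\<forall>z\<in>?F. finite (Collect (fst (g z))) \<and> finite (Collect (snd (g z))) \<and>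
      (\<exists>k. fst (g z) k) \<and>
      (\<forall>z'\<in>?F. \<forall>s. fst (g z) = translate s (fst (g z')) \<longrightarrow> z = translate2 s z')" ..
  have fin: "finite (Collect (fst (g z)))" "finite (Collect (snd (g z)))"
    and nz: "\<exists>k. fst (g z) k" if "z \<in> ?F" for z
    using bspec[OF generic that] by (simp_all only:)
  have inj: "fst (g z) \<noteq> translate s (fst (g f))"
    if "z \<in> ?F" "f \<in> F" "\<And>s. z \<noteq> translate2 s f" for z f s
    using bspec[OF generic that(1)] that(2,3) by (metis UnI2)
  obtain k k' where k: "fst (g x) k" "fst (g y) k'"
    using nz[of x] nz[of y] by (metis UnI1 insertCI)
  have "\<exists>h\<in>G. h (fst (g x), snd (g x)) = (fst (g y), snd (g y)) \<and> (\<forall>f\<in>g ` F. h f = f)"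
  proof (rule transitive_generic)
    show "fst (g x) k" "fst (g y) k'"
      by (rule k)+
    fix c d s assume "(c, d) \<in> g ` F"
    then obtain f where f: "f \<in> F" "c = fst (g f)" "d = snd (g f)"
      by (metis fst_conv imageE snd_conv)
    show "finite (Collect c) \<and> finite (Collect d)"
      using fin[of f] f by simp
    show "fst (g x) \<noteq> translate s c"
      unfolding f(2) by (rule inj) (use f(1) orbit(1) in simp_all)
    show "fst (g y) \<noteq> translate s c"
      unfolding f(2) by (rule inj) (use f(1) orbit(2) in simp_all)
  qed (use fin F(1) in simp_all)
  then obtain h where h: "h \<in> G" "h (g x) = g y" "\<And>f. f \<in> F \<Longrightarrow> h (g f) = g f"
    by auto
  obtain g' where "g' \<in> G" "\<And>z. g' (g z) = z"
    using left_inverse_in[OF g bij[OF g]] by blast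
  then show ?thesis
    using h g by (intro bexI[of _ "g' \<circ> (h \<circ> g)"] comp) auto
qed

end

section \<open>Automorphisms with finite radius\<close>

text \<open>This is the locality of a cellular automaton; commutation with the shift is kept
  separate.\<close>

definition has_radius :: "int \<Rightarrow> ((int \<Rightarrow> 'a) \<Rightarrow> int \<Rightarrow> 'a) \<Rightarrow> bool" where
  "has_radius r f \<longleftrightarrow>
    (\<forall>x y i. (\<forall>j. \<bar>j\<bar> \<le> r \<longrightarrow> x (i + j) = y (i + j)) \<longrightarrow> f x i = f y i)"

text \<open>Each coordinate of \<open>f x\<close> depends on finitely many coordinates of
  \<open>x\<close>, so each point of a preimage lies in a cylinder contained in that
  preimage.\<close>

lemma continuous_map_has_radius:
  assumes "has_radius r f"
  shows "continuous_map full_shift_topology full_shift_topology f"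
proof -
  let ?T = "product_topology (\<lambda>_ :: int. discrete_topology UNIV) UNIV"
  have "openin ?T {x. f x k \<in> U}" for k U
  proof (subst openin_subopen, intro ballI)
    fix x assume x: "x \<in> {x. f x k \<in> U}"
    let ?W = "PiE UNIV (\<lambda>j. if \<bar>j - k\<bar> \<le> r then {x j} else UNIV)"
    have "finite {j. (if \<bar>j - k\<bar> \<le> r then {x j} else UNIV) \<noteq> UNIV}"
      by (rule finite_subset[of _ "{k - r..k + r}"]) auto
    then have "openin ?T ?W"
      by (simp add: openin_PiE_gen)
    moreover have "x \<in> ?W" by auto
    moreover have "?W \<subseteq> {x. f x k \<in> U}"
    proof
      fix y assume y: "y \<in> ?W"
      have "y j = x j" if "\<bar>j - k\<bar> \<le> r" for j
        using y that PiE_mem[OF y, of j] by simp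
      then have "\<forall>j. \<bar>j\<bar> \<le> r \<longrightarrow> y (k + j) = x (k + j)"
        by simp
      then have "f y k = f x k"
        using assms unfolding has_radius_def by blast
      then show "y \<in> {x. f x k \<in> U}" using x by simp
    qed
    ultimately show "\<exists>W. openin ?T W \<and> x \<in> W \<and> W \<subseteq> {x. f x k \<in> U}"
      by blast
  qed
  then show ?thesis
    unfolding full_shift_topology_def continuous_map_componentwise_UNIV
    by (simp add: continuous_map_def)
qed

lemma has_radius_finite_support:
  fixes f :: "(int \<Rightarrow> 'a::zero) \<Rightarrow> int \<Rightarrow> 'a"
  assumes "has_radius r f" "f (\<lambda>_. 0) = (\<lambda>_. 0)" "finite {i. x i \<noteq> 0}"
  shows "finite {i. f x i \<noteq> 0}"
proof (rule finite_subset)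
  show "finite (\<Union>k\<in>{i. x i \<noteq> 0}. {k - r..k + r})"
    using assms(3) by blast
  show "{i. f x i \<noteq> 0} \<subseteq> (\<Union>k\<in>{i. x i \<noteq> 0}. {k - r..k + r})"
  proof
    fix i assume "i \<in> {i. f x i \<noteq> 0}"
    then have "f x i \<noteq> f (\<lambda>_. 0) i"
      using assms(2) by simp
    then obtain j where "\<bar>j\<bar> \<le> r" "x (i + j) \<noteq> 0"
      using assms(1) unfolding has_radius_def by metis
    then show "i \<in> (\<Union>k\<in>{i. x i \<noteq> 0}. {k - r..k + r})"
      by (intro UN_I[of "i + j"]) auto
  qed
qed

text \<open>The inverse comes with a radius of its own. This gives its continuity without a
  compactness argument, and it yields an equality of images instead of an inclusion.\<close>

lemma invertible_has_radius:
  fixes f g :: "(int \<Rightarrow> 'a::zero) \<Rightarrow> int \<Rightarrow> 'a"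
  assumes rad: "has_radius r f" "has_radius s g"
    and fg: "\<And>x. f (g x) = x" and gf: "\<And>x. g (f x) = x"
    and comm: "f \<circ> shift = shift \<circ> f" and zero: "f (\<lambda>_. 0) = (\<lambda>_. 0)"
  shows "f \<in> carrier full_shift_Aut" and "f ` nonzero_finite_points = nonzero_finite_points"
proof -
  have "homeomorphic_maps full_shift_topology full_shift_topology f g"
    using rad fg gf by (simp add: homeomorphic_maps_def continuous_map_has_radius)
  then show "f \<in> carrier full_shift_Aut"
    using comm homeomorphic_maps_map by (auto simp: full_shift_Aut_def)
  have zero': "g (\<lambda>_. 0) = (\<lambda>_. 0)"
    using gf[of "\<lambda>_. 0"] zero by simp
  have X: "x \<in> nonzero_finite_points \<longleftrightarrow> finite {i. x i \<noteq> 0} \<and> x \<noteq> (\<lambda>_. 0)"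
    for x :: "int \<Rightarrow> 'a"
    by (auto simp: nonzero_finite_points_def)
  have "f x \<in> nonzero_finite_points" if "x \<in> nonzero_finite_points" for x
    using that has_radius_finite_support[OF rad(1) zero] zero' gf unfolding X by metis
  moreover have "g x \<in> nonzero_finite_points" if "x \<in> nonzero_finite_points" for x
    using that has_radius_finite_support[OF rad(2) zero'] zero fg unfolding X by metis
  ultimately show "f ` nonzero_finite_points = nonzero_finite_points"
    using fg by (auto simp: image_iff) metis
qed

section \<open>Shift orbits and automorphisms\<close>

lemma shift_orbit_eq: "shift_orbit x = range (\<lambda>n. translate n x)"
  by (auto simp: shift_orbit_def shift_int_pow translate_def)

lemma shift_orbit_translate: "shift_orbit (translate n x) = shift_orbit x"
proof -
  have "translate m x \<in> range (\<lambda>m. translate (m + n) x)" for m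
    by (rule range_eqI[of _ _ "m - n"]) simp
  then show ?thesis
    by (auto simp: shift_orbit_eq)
qed

lemma Aut_translate:
  assumes "f \<in> carrier full_shift_Aut"
  shows "f (translate n x) = translate n (f x)"
proof -
  have comm: "f (translate 1 x) = translate 1 (f x)" for x
    using assms by (auto simp: full_shift_Aut_def fun_eq_iff shift_def translate_def)
  show ?thesis
  proof (induction n rule: int_induct[of _ 0])
    case base then show ?case by simp
  next
    case (step1 i)
    then have "f (translate (1 + i) x) = translate (1 + i) (f x)"
      using comm[of "translate i x"] by (simp only: translate_translate)
    then show ?case by (simp only: add.commute)
  next
    case (step2 i)
    have "translate 1 (translate (i - 1) x) = translate i x"
      by (simp add: translate_def)
    then have "translate 1 (f (translate (i - 1) x)) = translate i (f x)"
      using comm[of "translate (i - 1) x"] step2 by (simp only:)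
    then have "translate (- 1) (translate 1 (f (translate (i - 1) x))) =
        translate (- 1) (translate i (f x))"
      by (simp only:)
    then show ?case
      by (simp only: translate_translate add.left_inverse translate_0 uminus_add_conv_diff diff_self)
  qed
qed

lemma shift_orbit_Aut:
  assumes "f \<in> carrier full_shift_Aut"
  shows "shift_orbit (f x) = f ` shift_orbit x"
  unfolding shift_orbit_eq image_image Aut_translate[OF assms] ..

lemma Aut_bij:
  assumes "f \<in> carrier full_shift_Aut"
  shows "bij f"
  using assms homeomorphic_imp_injective_map homeomorphic_imp_surjective_map
  by (fastforce simp: full_shift_Aut_def bij_def)

section \<open>From stabilizers to tuples\<close>

text \<open>Induction on \<open>k\<close>: once \<open>g\<close> handles the first \<open>k\<close>
  points, an element of the stabilizer of their targets corrects the image of the next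
  point.\<close>

lemma inf_orbit_transitive_of_stabilizers:
  fixes G :: "((int \<Rightarrow> 'a) \<Rightarrow> int \<Rightarrow> 'a) set"
  assumes "subgroup G full_shift_Aut" and inv: "\<And>g. g \<in> G \<Longrightarrow> g ` X \<subseteq> X"
    and stab: "\<And>F x y. finite F \<Longrightarrow> F \<subseteq> X \<Longrightarrow> x \<in> X \<Longrightarrow> y \<in> X \<Longrightarrow>
      shift_orbit x \<notin> shift_orbit ` F \<Longrightarrow> shift_orbit y \<notin> shift_orbit ` F \<Longrightarrow>
      \<exists>g\<in>G. g x = y \<and> (\<forall>f\<in>F. g f = f)"
  shows "inf_orbit_transitive_on G X"
proof -
  interpret subgroup G full_shift_Aut by fact
  have comp: "g \<circ> h \<in> G" if "g \<in> G" "h \<in> G" for g h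
    using m_closed[OF that] by (simp add: full_shift_Aut_def)
  have "\<exists>g\<in>G. \<forall>i\<in>{1..k}. g (x i) = y i"
    if "\<forall>i\<in>{1..k}. x i \<in> X" "\<forall>i\<in>{1..k}. y i \<in> X"
      "\<forall>i\<in>{1..k}. \<forall>j\<in>{1..k}. i \<noteq> j \<longrightarrow> shift_orbit (x i) \<noteq> shift_orbit (x j)"
      "\<forall>i\<in>{1..k}. \<forall>j\<in>{1..k}. i \<noteq> j \<longrightarrow> shift_orbit (y i) \<noteq> shift_orbit (y j)"
    for k :: nat and x y :: "nat \<Rightarrow> int \<Rightarrow> 'a"
    using that
  proof (induction k)
    case 0
    show ?case by (intro bexI[OF _ one_closed]) auto
  next
    case (Suc k)
    have "\<exists>g\<in>G. \<forall>i\<in>{1..k}. g (x i) = y i"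
      by (rule Suc.IH) (use Suc.prems in auto)
    then obtain g where g: "g \<in> G" "\<And>i. i \<in> {1..k} \<Longrightarrow> g (x i) = y i"
      by blast
    have g_Aut: "g \<in> carrier full_shift_Aut" using g(1) by (rule mem_carrier)
    \<comment> \<open>The automorphism \<open>g\<close> is injective and maps orbits onto orbits, so
      the moved point stays outside the orbits of the earlier targets.\<close>
    have "shift_orbit (g (x (Suc k))) \<noteq> shift_orbit (y i)" if i: "i \<in> {1..k}" for i
    proof -
      have "shift_orbit (x (Suc k)) \<noteq> shift_orbit (x i)"
        using Suc.prems(3) i by auto
      then show ?thesis
        using Aut_bij[OF g_Aut]
        by (simp add: g(2)[OF i, symmetric] shift_orbit_Aut[OF g_Aut] bij_is_inj inj_image_eq_iff)
    qed
    moreover have "shift_orbit (y (Suc k)) \<noteq> shift_orbit (y i)" if "i \<in> {1..k}" for i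
      using Suc.prems(4) that by auto
    moreover have "g (x (Suc k)) \<in> X"
      using inv[OF g(1)] Suc.prems(1) by auto
    ultimately obtain h where h: "h \<in> G" "h (g (x (Suc k))) = y (Suc k)"
        "\<forall>f\<in>y ` {1..k}. h f = f"
      using stab[of "y ` {1..k}" "g (x (Suc k))" "y (Suc k)"] Suc.prems(2)
      by (smt (verit) atLeastAtMost_iff finite_atLeastAtMost finite_imageI image_iff
          image_subset_iff le_Suc_eq le_add1 plus_1_eq_Suc)
    have "(h \<circ> g) (x i) = y i" if "i \<in> {1..Suc k}" for i
      using that g(2)[of i] h by (cases "i = Suc k") auto
    then show ?case
      using comp[OF h(1) g(1)] by blast
  qed
  then show ?thesis
    using inv unfolding inf_orbit_transitive_on_def by blast
qed

section \<open>Symbols as pairs of bits\<close>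

text \<open>Binary digits, with the low bit on the first track. The symbol 0 becomes two zero bits,
  so nonzero finite points become nonzero finite tracks.\<close>

definition to_tracks :: "(int \<Rightarrow> 4) \<Rightarrow> tracks" where
  "to_tracks x = (\<lambda>i. x i = 1 \<or> x i = 3, \<lambda>i. x i = 2 \<or> x i = 3)"

definition of_tracks :: "tracks \<Rightarrow> int \<Rightarrow> 4" where
  "of_tracks = (\<lambda>(a, b) i. if a i then if b i then 3 else 1 else if b i then 2 else 0)"

lemma to_of_tracks [simp]: "to_tracks (of_tracks t) = t"
  by (auto simp: to_tracks_def of_tracks_def fun_eq_iff split: prod.splits)

lemma of_to_tracks [simp]: "of_tracks (to_tracks x) = x"
proof
  fix i
  have "x i \<in> {0, 1, 2, 3}"
    using UNIV_4 by blast
  then show "of_tracks (to_tracks x) i = x i"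
    by (auto simp: to_tracks_def of_tracks_def)
qed

lemma of_tracks_translate2: "of_tracks (translate2 n t) = translate n (of_tracks t)"
  by (auto simp: of_tracks_def translate2_def fun_eq_iff split: prod.splits)

lemma to_tracks_translate: "to_tracks (translate n x) = translate2 n (to_tracks x)"
  by (auto simp: to_tracks_def translate2_def fun_eq_iff)

lemma to_tracks_nonzero_finite:
  assumes "x \<in> nonzero_finite_points"
  shows "to_tracks x \<in> nonzero_finite_tracks"
proof -
  have cases: "x i = 0 \<or> x i = 1 \<or> x i = 2 \<or> x i = 3" for i
    using UNIV_4 by blast
  have fin: "finite {i. x i \<noteq> 0}" and "\<exists>i. x i \<noteq> 0"
    using assms by (auto simp: nonzero_finite_points_def)
  moreover have "finite {i. x i = 1 \<or> x i = 3}" "finite {i. x i = 2 \<or> x i = 3}"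
    using fin by (auto elim!: finite_subset[rotated])
  ultimately show ?thesis
    using cases by (auto simp: nonzero_finite_tracks_def to_tracks_def)
qed

definition lift_gate :: "(tracks \<Rightarrow> tracks) \<Rightarrow> (int \<Rightarrow> 4) \<Rightarrow> int \<Rightarrow> 4" where
  "lift_gate g = of_tracks \<circ> g \<circ> to_tracks"

lemma lift_gate_comp: "lift_gate (g \<circ> h) = lift_gate g \<circ> lift_gate h"
  by (simp add: lift_gate_def fun_eq_iff)

lemma lift_gate_id: "lift_gate id = id"
  by (simp add: lift_gate_def fun_eq_iff)

text \<open>The three offsets are listed explicitly so that the condition unfolds by rewriting for a
  concrete gate.\<close>

definition gate_radius_1 :: "(tracks \<Rightarrow> tracks) \<Rightarrow> bool" where
  "gate_radius_1 g \<longleftrightarrow> (\<forall>a b a' b' i.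
    (\<forall>j\<in>{- 1, 0, 1}. a (i + j) = a' (i + j) \<and> b (i + j) = b' (i + j)) \<longrightarrow>
    fst (g (a, b)) i = fst (g (a', b')) i \<and> snd (g (a, b)) i = snd (g (a', b')) i)"

lemma has_radius_lift_gate:
  assumes "gate_radius_1 g"
  shows "has_radius 1 (lift_gate g)"
  unfolding has_radius_def
proof (intro allI impI)
  fix x y :: "int \<Rightarrow> 4" and i :: int
  assume eq: "\<forall>j. \<bar>j\<bar> \<le> 1 \<longrightarrow> x (i + j) = y (i + j)"
  have "x (i + j) = y (i + j)" if "j \<in> {- 1, 0, 1}" for j
    using eq[rule_format, of j] that by fastforce
  then have "\<forall>j\<in>{- 1, 0, 1}. fst (to_tracks x) (i + j) = fst (to_tracks y) (i + j) \<and>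
      snd (to_tracks x) (i + j) = snd (to_tracks y) (i + j)"
    unfolding to_tracks_def by (intro ballI) (simp only: fst_conv snd_conv simp_thms)
  from assms[unfolded gate_radius_1_def, THEN spec, THEN spec, THEN spec, THEN spec, THEN spec,
      THEN mp, OF this]
  have "fst (g (to_tracks x)) i = fst (g (to_tracks y)) i \<and>
      snd (g (to_tracks x)) i = snd (g (to_tracks y)) i"
    by (simp only: prod.collapse)
  then show "lift_gate g x i = lift_gate g y i"
    by (simp add: lift_gate_def of_tracks_def case_prod_unfold)
qed

lemma lift_gate_invertible:
  assumes "gate_radius_1 g" "gate_radius_1 h" "g \<circ> h = id" "h \<circ> g = id"
    and comm: "\<And>t. g (translate2 1 t) = translate2 1 (g t)"
    and zero: "g (\<lambda>_. False, \<lambda>_. False) = (\<lambda>_. False, \<lambda>_. False)"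
  shows "lift_gate g \<in> carrier full_shift_Aut \<and>
    lift_gate g ` nonzero_finite_points = nonzero_finite_points"
proof -
  have eq: "g (h t) = t" "h (g t) = t" for t
    using fun_cong[OF assms(3), of t] fun_cong[OF assms(4), of t] by simp_all
  have inv: "lift_gate g (lift_gate h x) = x" "lift_gate h (lift_gate g x) = x" for x
    by (simp_all add: lift_gate_def eq)
  have shift: "shift x = translate 1 x" for x :: "int \<Rightarrow> 4"
    by (simp add: shift_def translate_def)
  have lift_comm: "lift_gate g \<circ> shift = shift \<circ> lift_gate g"
    by (rule ext) (simp only: comp_apply lift_gate_def shift to_tracks_translate comm
        of_tracks_translate2)
  have "lift_gate g (\<lambda>_. 0) = (\<lambda>_. 0)"
    using zero by (simp add: lift_gate_def to_tracks_def of_tracks_def)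
  then show ?thesis
    using invertible_has_radius[OF assms(1,2)[THEN has_radius_lift_gate] inv lift_comm] by blast
qed

section \<open>The generators and the group they generate\<close>

definition generating_gates :: "(tracks \<Rightarrow> tracks) set" where
  "generating_gates = {prod.swap, first_shift 1, add_gate (\<lambda>c. c 0),
    controlled_gate True, controlled_gate False}"

lemma generating_gates_invertible:
  assumes "g \<in> generating_gates"
  shows "lift_gate g \<in> carrier full_shift_Aut \<and>
    lift_gate g ` nonzero_finite_points = nonzero_finite_points"
proof -
  note gate_defs = add_gate_def controlled_gate_def first_shift_def step_def
  have radius: "gate_radius_1 g"
    using assms unfolding generating_gates_def
    by (elim insertE emptyE; simp add: gate_radius_1_def gate_defs add.commute[of 1])
  have "\<exists>h. gate_radius_1 h \<and> g \<circ> h = id \<and> h \<circ> g = id"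
  \<comment> \<open>All generators but the shift of the first track are involutions and serve as
    their own inverses.\<close>
  proof (cases "g = first_shift 1")
    case True
    have "gate_radius_1 (first_shift (- 1))"
      by (simp add: gate_radius_1_def first_shift_def)
    then show ?thesis
      using True by (intro exI[of _ "first_shift (- 1)"])
        (simp add: first_shift_comp first_shift_0)
  next
    case False
    then have "g \<circ> g = id"
      using assms
      by (auto simp: generating_gates_def add_gate_involution controlled_gate_involution)
    then show ?thesis using radius by blast
  qed
  moreover have "g (translate2 1 (a, b)) = translate2 1 (g (a, b))" for a b
    using assms unfolding generating_gates_def
    by (elim insertE emptyE; auto simp: gate_defs translate2_def translate_def ac_simps)
  then have "g (translate2 1 t) = translate2 1 (g t)" for t
    by (cases t) (simp only:)
  moreover have "g (\<lambda>_. False, \<lambda>_. False) = (\<lambda>_. False, \<lambda>_. False)"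
    using assms unfolding generating_gates_def
    by (elim insertE emptyE; simp add: gate_defs translate_def)
  ultimately show ?thesis
    using lift_gate_invertible[OF radius] by blast
qed

theorem theorem2p1:
  shows "\<exists>G :: ((int \<Rightarrow> 4) \<Rightarrow> (int \<Rightarrow> 4)) set.
    finitely_generated_subgroup G full_shift_Aut \<and>
    inf_orbit_transitive_on G nonzero_finite_points"
proof -
  let ?A = "full_shift_Aut :: ((int \<Rightarrow> 4) \<Rightarrow> int \<Rightarrow> 4) monoid"
  let ?X = "nonzero_finite_points :: (int \<Rightarrow> 4) set"
  interpret A: group ?A by (rule group_full_shift_Aut)
  have mult: "g \<otimes>\<^bsub>?A\<^esub> h = g \<circ> h" and one_id: "\<one>\<^bsub>?A\<^esub> = id" for g h
    by (simp_all add: full_shift_Aut_def)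
  define S where "S = lift_gate ` generating_gates"
  define G where "G = generate ?A S"
  have S: "finite S" "S \<subseteq> carrier ?A"
    using generating_gates_invertible by (auto simp: S_def generating_gates_def)
  have G: "subgroup G ?A"
    unfolding G_def using S(2) by (rule A.generate_is_subgroup)
  interpret G: subgroup G ?A by fact
  have inv_left: "inv\<^bsub>?A\<^esub> g \<circ> g = id" if "g \<in> carrier ?A" for g
    using A.l_inv[OF that] by (simp add: mult one_id)
  have S_X: "g ` ?X = ?X" if "g \<in> S" for g
    using generating_gates_invertible that by (auto simp: S_def)
  have X: "g ` ?X = ?X" if "g \<in> G" for g
    using that unfolding G_def
  proof (induction rule: generate.induct)
    case one then show ?case by (simp add: one_id)
  next
    case (incl h) then show ?case by (rule S_X)
  next
    case (inv h)
    have "(inv\<^bsub>?A\<^esub> h) (h x) = x" for x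
      using fun_cong[OF inv_left, of h x] inv S(2) by auto
    \<comment> \<open>Generators map the nonzero finite points onto themselves, not merely into
      themselves, so their inverses preserve this set too.\<close>
    then have "(inv\<^bsub>?A\<^esub> h) ` (h ` ?X) = ?X"
      by (simp add: image_image)
    then show ?case using S_X[OF inv] by simp
  next
    case (eng g h) then show ?case by (simp only: mult image_comp[symmetric])
  qed
  \<comment> \<open>All gates with lift in \<open>G\<close> are taken, so closure is inherited from
    \<open>G\<close> and no words in the generators are needed.\<close>
  define T where "T = {g. lift_gate g \<in> G}"
  have gen: "g \<in> T" if "g \<in> generating_gates" for g
    using that generate.incl[of "lift_gate g" S ?A] by (simp add: T_def G_def S_def)
  interpret T: gate_group T
  proof
    show "g \<circ> h \<in> T" if "g \<in> T" "h \<in> T" for g h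
      using that G.m_closed unfolding T_def by (simp add: lift_gate_comp mult)
    show "h \<in> T" if g: "g \<in> T" and gh: "g \<circ> h = id" for g h
    proof -
      have "lift_gate g \<circ> lift_gate h = id"
        by (metis lift_gate_comp lift_gate_id gh)
      moreover have "inv\<^bsub>?A\<^esub> lift_gate g \<circ> lift_gate g = id"
        using g by (intro inv_left G.mem_carrier) (simp add: T_def)
      \<comment> \<open>A right inverse of an invertible map equals its inverse, and
        \<open>G\<close> contains the latter.\<close>
      ultimately have "lift_gate h = inv\<^bsub>?A\<^esub> lift_gate g"
        by (metis comp_assoc comp_id id_comp)
      then show ?thesis using g G.m_inv_closed by (simp add: T_def)
    qed
    show "controlled_gate v \<in> T" for v
      by (rule gen) (cases v; simp add: generating_gates_def)
  qed (rule gen, simp add: generating_gates_def)+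
  have bij: "bij g" if "g \<in> T" for g
  proof -
    have "bij (lift_gate g)"
      using that by (intro Aut_bij G.mem_carrier) (simp add: T_def)
    moreover have "bij to_tracks" "bij of_tracks"
      by (rule bijI'; metis of_to_tracks to_of_tracks)+
    moreover have "g = to_tracks \<circ> lift_gate g \<circ> of_tracks"
      by (simp add: lift_gate_def fun_eq_iff)
    ultimately show ?thesis by (metis bij_comp)
  qed
  have "inf_orbit_transitive_on G ?X"
  proof (rule inf_orbit_transitive_of_stabilizers[OF G])
    show "g ` ?X \<subseteq> ?X" if "g \<in> G" for g
      using X[OF that] by simp
    fix F x y
    assume F: "finite F" "F \<subseteq> ?X" and xy: "x \<in> ?X" "y \<in> ?X"
      and orbit: "shift_orbit x \<notin> shift_orbit ` F" "shift_orbit y \<notin> shift_orbit ` F"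
    \<comment> \<open>Translates of pairs of tracks correspond to translates of points, so different
      shift orbits give tracks that are not translates of each other.\<close>
    have ne: "to_tracks z \<noteq> translate2 s f"
      if z: "shift_orbit z \<notin> shift_orbit ` F" and f: "f \<in> to_tracks ` F" for z f s
    proof
      assume eq: "to_tracks z = translate2 s f"
      obtain f' where f': "f' \<in> F" "f = to_tracks f'" using f by blast
      have "z = of_tracks (translate2 s f)"
        unfolding eq[symmetric] by simp
      then have "z = translate s f'"
        by (simp add: of_tracks_translate2 f'(2))
      then show False
        using z f'(1) by (simp add: shift_orbit_translate)
    qed
    have "\<exists>g\<in>T. g (to_tracks x) = to_tracks y \<and> (\<forall>f\<in>to_tracks ` F. g f = f)"
      using F xy orbit ne bij to_tracks_nonzero_finite
      by (intro T.transitive_stabilizer) auto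
    then obtain g where "g \<in> T" "g (to_tracks x) = to_tracks y"
      "\<forall>f\<in>F. g (to_tracks f) = to_tracks f"
      by blast
    then show "\<exists>g\<in>G. g x = y \<and> (\<forall>f\<in>F. g f = f)"
      by (intro bexI[of _ "lift_gate g"]) (auto simp: lift_gate_def T_def)
  qed
  moreover have "finitely_generated_subgroup G ?A"
    using G S by (auto simp: finitely_generated_subgroup_def G_def)
  ultimately show ?thesis by blast
qed

end
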